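(* Let $a_1,\ldots,a_d\in\mathbb{C}$ satisfy $\sum_{i=1}^d|a_i|\le1$. Then the polynomial $p(z_1,\ldots,z_d)=1-\sum_{i=1}^da_iz_i$ is an Agler denominator.
   Context: A polynomial is semi-stable if it has no zeros in $\mathbb{D}^d=\{z\in\mathbb{C}^d:|z_i|<1,\ i=1,\dots,d\}$. The multi-degree $\deg p=(m_1,\ldots,m_d)$ has $m_i$ equal to the degree of $p$ as a polynomial in $z_i$; $\bar p(z):=\overline{p(\bar z)}$; $1/z=(1/z_1,\ldots,1/z_d)$; $z^m=z_1^{m_1}\cdots z_d^{m_d}$. The (scalar) Schur--Agler class $\mathcal{SA}_d$ consists of analytic functions $f(z)=\sum_k f_kz^k$ on $\mathbb{D}^d$ such that $\sup_T\|f(T)\|\le1$, where the supremum is over all $d$-tuples $T=(T_1,\ldots,T_d)$ of commuting strict contractions on a common Hilbert space and $f(T)=\sum_kf_kT^k$. A semi-stable polynomial $p$ is an Agler denominator if the rational inner function $z^{\deg p}\bar p(1/z)/p(z)$ belongs to $\mathcal{SA}_d$. *)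

theory Defs
  imports "HOL-Analysis.Analysis" "HOL-Library.Poly_Mapping"
begin

section \<open>Complex Hilbert spaces\<close>

text \<open>
  The inner product is linear in its first argument.  The norm and the real scaling are those
  of \<^class>\<open>real_normed_vector\<close>, so that the type of bounded operators and its operator norm
  are available.
\<close>

class complex_inner = real_normed_vector +
  fixes scaleC :: "complex \<Rightarrow> 'a \<Rightarrow> 'a"  (infixr "*\<^sub>C" 75)
    and cinner :: "'a \<Rightarrow> 'a \<Rightarrow> complex"
  assumes scaleC_add_right: "a *\<^sub>C (x + y) = a *\<^sub>C x + a *\<^sub>C y"
    and scaleC_add_left: "(a + b) *\<^sub>C x = a *\<^sub>C x + b *\<^sub>C x"
    and scaleC_scaleC: "a *\<^sub>C (b *\<^sub>C x) = (a * b) *\<^sub>C x"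
    and scaleR_eq_scaleC: "r *\<^sub>R x = complex_of_real r *\<^sub>C x"
    and cinner_commute: "cinner x y = cnj (cinner y x)"
    and cinner_add_left: "cinner (x + y) z = cinner x z + cinner y z"
    and cinner_scaleC_left: "cinner (a *\<^sub>C x) y = a * cinner x y"
    and cinner_ge_zero: "0 \<le> Re (cinner x x)"
    and cinner_eq_zero_iff: "cinner x x = 0 \<longleftrightarrow> x = 0"
    and norm_eq_sqrt_cinner: "norm x = sqrt (Re (cinner x x))"

class chilbert_space = complex_inner + complete_space

instantiation complex :: chilbert_space
begin

definition scaleC_complex :: "complex \<Rightarrow> complex \<Rightarrow> complex"
  where "scaleC_complex a x = a * x"

definition cinner_complex :: "complex \<Rightarrow> complex \<Rightarrow> complex"
  where "cinner_complex x y = x * cnj y"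

instance
proof
  fix x :: complex
  show "norm x = sqrt (Re (cinner x x))"
    by (simp add: cinner_complex_def cmod_def power2_eq_square)
qed (auto simp: scaleC_complex_def cinner_complex_def algebra_simps scaleR_conv_of_real)

end

lemma norm_scaleC: "norm (a *\<^sub>C x) = cmod a * norm (x :: 'h::complex_inner)"
proof -
  have "cinner (a *\<^sub>C x) (a *\<^sub>C x) = a * cnj (a * cinner x x)"
    by (metis cinner_commute cinner_scaleC_left)
  also have "\<dots> = (a * cnj a) * cinner x x"
    by (simp add: cinner_commute [of x x, symmetric])
  also have "\<dots> = complex_of_real ((cmod a)\<^sup>2) * cinner x x"
    by (metis complex_norm_square)
  finally have "Re (cinner (a *\<^sub>C x) (a *\<^sub>C x)) = (cmod a)\<^sup>2 * Re (cinner x x)"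
    by simp
  then show ?thesis
    by (simp add: norm_eq_sqrt_cinner [where 'a = 'h] real_sqrt_mult)
qed


section \<open>The Schur--Agler class\<close>

definition polydisc :: "(complex ^ 'n) set"
  where "polydisc = {z. \<forall>i. cmod (z $ i) < 1}"

definition monomial_val :: "complex ^ 'n \<Rightarrow> ('n::finite \<Rightarrow> nat) \<Rightarrow> complex"
  where "monomial_val z k = (\<Prod>i\<in>UNIV. (z $ i) ^ k i)"

lift_definition scaleC_blinfun :: "complex \<Rightarrow> ('h::complex_inner \<Rightarrow>\<^sub>L 'h) \<Rightarrow> ('h \<Rightarrow>\<^sub>L 'h)"
  is "\<lambda>c A x. c *\<^sub>C A x"
proof -
  fix c :: complex and A :: "'h \<Rightarrow> 'h"
  assume "bounded_linear A"
  then interpret bounded_linear A .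
  show "bounded_linear (\<lambda>x. c *\<^sub>C A x)"
  proof
    fix r x
    show "c *\<^sub>C A (r *\<^sub>R x) = r *\<^sub>R (c *\<^sub>C A x)"
      unfolding scaleR by (simp add: scaleR_eq_scaleC scaleC_scaleC mult.commute)
    obtain K where K: "\<And>x. norm (A x) \<le> norm x * K"
      using bounded by blast
    show "\<exists>K. \<forall>x. norm (c *\<^sub>C A x) \<le> norm x * K"
      using mult_left_mono [OF K, of "cmod c"]
      by (intro exI [of _ "cmod c * K"]) (auto simp: norm_scaleC mult.left_commute)
  qed (simp add: add scaleC_add_right)
qed

text \<open>
  The type \<open>'h \<Rightarrow>\<^sub>L 'h\<close> consists of the real-linear bounded operators, so complex linearity is
  required separately.
\<close>

definition commuting_strict_contractions :: "('n \<Rightarrow> ('h::complex_inner \<Rightarrow>\<^sub>L 'h)) \<Rightarrow> bool"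
  where "commuting_strict_contractions T \<longleftrightarrow>
    (\<forall>i c x. T i (c *\<^sub>C x) = c *\<^sub>C T i x) \<and>
    (\<forall>i. norm (T i) < 1) \<and>
    (\<forall>i j. T i o\<^sub>L T j = T j o\<^sub>L T i)"

definition blinfun_pow :: "('h::real_normed_vector \<Rightarrow>\<^sub>L 'h) \<Rightarrow> nat \<Rightarrow> ('h \<Rightarrow>\<^sub>L 'h)"
  where "blinfun_pow A n = ((o\<^sub>L) A ^^ n) id_blinfun"

text \<open>
  The product of the powers is taken in an unspecified order; it is well defined because the
  operators commute (lemma \<open>op_monomial_insert\<close>).
\<close>

definition op_monomial_on ::
    "'n set \<Rightarrow> ('n \<Rightarrow> ('h::real_normed_vector \<Rightarrow>\<^sub>L 'h)) \<Rightarrow> ('n \<Rightarrow> nat) \<Rightarrow> ('h \<Rightarrow>\<^sub>L 'h)"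
  where "op_monomial_on I T k =
    Finite_Set.fold (\<lambda>i A. blinfun_pow (T i) (k i) o\<^sub>L A) id_blinfun I"

abbreviation op_monomial ::
    "('n::finite \<Rightarrow> ('h::real_normed_vector \<Rightarrow>\<^sub>L 'h)) \<Rightarrow> ('n \<Rightarrow> nat) \<Rightarrow> ('h \<Rightarrow>\<^sub>L 'h)"
  where "op_monomial \<equiv> op_monomial_on UNIV"

lemma blinfun_pow_0 [simp]: "blinfun_pow A 0 = id_blinfun"
  and blinfun_pow_Suc: "blinfun_pow A (Suc n) = A o\<^sub>L blinfun_pow A n"
  by (simp_all add: blinfun_pow_def)

lemma blinfun_pow_commute:
  assumes "A o\<^sub>L B = B o\<^sub>L A"
  shows "blinfun_pow A m o\<^sub>L blinfun_pow B n = blinfun_pow B n o\<^sub>L blinfun_pow A m"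
proof -
  have AB: "A (B x) = B (A x)" for x
    using assms by (metis blinfun_apply_blinfun_compose)
  have 1: "A (blinfun_pow B n x) = blinfun_pow B n (A x)" for x
    by (induction n arbitrary: x) (simp_all add: blinfun_pow_Suc AB)
  have "blinfun_pow A m (blinfun_pow B n x) = blinfun_pow B n (blinfun_pow A m x)" for x
    by (induction m arbitrary: x) (simp_all add: blinfun_pow_Suc 1)
  then show ?thesis
    by (intro blinfun_eqI) simp
qed

lemma op_monomial_empty: "op_monomial_on {} T k = id_blinfun"
  by (simp add: op_monomial_on_def)

lemma op_monomial_insert:
  assumes "commuting_strict_contractions T" and "finite I" and "i \<notin> I"
  shows "op_monomial_on (insert i I) T k = blinfun_pow (T i) (k i) o\<^sub>L op_monomial_on I T k"
proof -
  interpret comp_fun_commute "\<lambda>i A. blinfun_pow (T i) (k i) o\<^sub>L A"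
  proof
    fix i j
    have "blinfun_pow (T i) (k i) o\<^sub>L blinfun_pow (T j) (k j) =
          blinfun_pow (T j) (k j) o\<^sub>L blinfun_pow (T i) (k i)"
      using assms(1) by (intro blinfun_pow_commute) (simp add: commuting_strict_contractions_def)
    then have "blinfun_pow (T i) (k i) (blinfun_pow (T j) (k j) x) =
          blinfun_pow (T j) (k j) (blinfun_pow (T i) (k i) x)" for x
      by (metis blinfun_apply_blinfun_compose)
    then show "((o\<^sub>L) (blinfun_pow (T j) (k j))) \<circ> ((o\<^sub>L) (blinfun_pow (T i) (k i))) =
          ((o\<^sub>L) (blinfun_pow (T i) (k i))) \<circ> ((o\<^sub>L) (blinfun_pow (T j) (k j)))"
      by (auto intro!: blinfun_eqI)
  qed
  show ?thesis
    using assms(2,3) by (simp add: op_monomial_on_def)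
qed

text \<open>
  The coefficients \<open>c\<close> are determined by the values of \<open>f\<close> on the polydisc.  The sum defining
  \<open>f(T)\<close> is taken in operator norm.  Since a type cannot be quantified inside a formula, the
  Hilbert space enters as a type argument; a statement about all Hilbert spaces is one in which
  the type variable \<open>'h\<close> is free.
\<close>

definition schur_agler :: "'h::chilbert_space itself \<Rightarrow> (complex ^ 'n::finite \<Rightarrow> complex) \<Rightarrow> bool"
  where "schur_agler _ f \<longleftrightarrow>
    (\<exists>c :: ('n \<Rightarrow> nat) \<Rightarrow> complex.
      (\<forall>z\<in>polydisc. ((\<lambda>k. c k * monomial_val z k) has_sum f z) UNIV) \<and>
      (\<forall>T :: 'n \<Rightarrow> ('h \<Rightarrow>\<^sub>L 'h). commuting_strict_contractions T \<longrightarrow>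
        (\<exists>F. ((\<lambda>k. scaleC_blinfun (c k) (op_monomial T k)) has_sum F) UNIV \<and> norm F \<le> 1)))"


section \<open>Polynomials and Agler denominators\<close>

text \<open>Polynomials are finitely supported maps from exponent vectors to coefficients.\<close>

type_synonym 'n cpoly = "('n \<Rightarrow>\<^sub>0 nat) \<Rightarrow>\<^sub>0 complex"

definition poly_const :: "complex \<Rightarrow> 'n cpoly"
  where "poly_const a = Poly_Mapping.single 0 a"

definition poly_var :: "'n \<Rightarrow> 'n cpoly"
  where "poly_var i = Poly_Mapping.single (Poly_Mapping.single i 1) 1"

definition eval_poly :: "'n::finite cpoly \<Rightarrow> complex ^ 'n \<Rightarrow> complex"
  where "eval_poly p z =
    (\<Sum>k\<in>Poly_Mapping.keys p. poly_mapping.lookup p k * monomial_val z (poly_mapping.lookup k))"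

definition multidegree :: "'n cpoly \<Rightarrow> 'n \<Rightarrow> nat"
  where "multidegree p i = Max (insert 0 ((\<lambda>k. poly_mapping.lookup k i) ` Poly_Mapping.keys p))"

definition semi_stable :: "'n::finite cpoly \<Rightarrow> bool"
  where "semi_stable p \<longleftrightarrow> (\<forall>z\<in>polydisc. eval_poly p z \<noteq> 0)"

text \<open>
  The numerator \<open>z\<^sup>m cnj (p (cnj (1/z)))\<close>, where \<open>m\<close> is the multidegree of \<open>p\<close>, is a polynomial
  in \<open>z\<close>.  It is written out as such because the literal expression takes wrong values when some
  coordinate of \<open>z\<close> is zero; lemma \<open>reflected_eq\<close> shows agreement at all other points.
\<close>

definition reflected :: "'n::finite cpoly \<Rightarrow> complex ^ 'n \<Rightarrow> complex"
  where "reflected p z =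
    (\<Sum>k\<in>Poly_Mapping.keys p.
      cnj (poly_mapping.lookup p k) * monomial_val z (\<lambda>i. multidegree p i - poly_mapping.lookup k i))"

lemma lookup_le_multidegree:
  "k \<in> Poly_Mapping.keys p \<Longrightarrow> poly_mapping.lookup k i \<le> multidegree p i"
  unfolding multidegree_def by (intro Max_ge) auto

lemma reflected_eq:
  assumes "\<And>i. z $ i \<noteq> 0"
  shows "reflected p z =
    monomial_val z (multidegree p) * cnj (eval_poly p (\<chi> i. cnj (1 / z $ i)))"
proof -
  have "monomial_val z (\<lambda>i. multidegree p i - poly_mapping.lookup k i) =
      monomial_val z (multidegree p) * cnj (monomial_val (\<chi> i. cnj (1 / z $ i)) (poly_mapping.lookup k))"
    if "k \<in> Poly_Mapping.keys p" for k
    using assms lookup_le_multidegree [OF that]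
    by (simp add: monomial_val_def power_diff divide_inverse power_inverse
        flip: prod.distrib)
  then show ?thesis
    by (simp add: reflected_def eval_poly_def sum_distrib_left mult.left_commute)
qed

definition agler_denominator :: "'h::chilbert_space itself \<Rightarrow> 'n::finite cpoly \<Rightarrow> bool"
  where "agler_denominator H p \<longleftrightarrow>
    semi_stable p \<and> schur_agler H (\<lambda>z. reflected p z / eval_poly p z)"

end

theory Submission
  imports Defs
begin

text \<open>
  Let \<open>q\<close> be the reflection of \<open>p\<close>.  For commuting strict contractions \<open>T\<close> the operator \<open>p(T)\<close>
  has an inverse given by a norm convergent power series, so the claim is
  \<open>|q(T) x| \<le> |p(T) x|\<close> for all vectors \<open>x\<close>.

  Rotating the variables, take \<open>a\<^sub>i \<ge> 0\<close>; by continuity, take \<open>\<Sum> a\<^sub>i < 1\<close>.  Let \<open>K = u u\<^sup>T\<close> with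
  \<open>u\<^sub>i = sqrt a\<^sub>i\<close>, a strict contraction, let \<open>Z\<close> be the diagonal matrix of the variables, and
  \<open>D = (1 - K\<^sup>2)\<^bsup>-1/2\<^esup>\<close>.  Up to the common factor \<open>det D\<close>, the determinants of \<open>C = D (1 - K Z)\<close>
  and \<open>B = D (Z - K)\<close> are \<open>p\<close> and \<open>q\<close>, and \<open>|B y| \<le> |C y|\<close> for vectors \<open>y\<close> of Hilbert space
  elements when \<open>Z\<close> is made of contractions.  Since the entries commute, this inequality passes
  to the determinants.
\<close>

section \<open>Determinants of commuting operators\<close>

text \<open>A map is determined by its value at \<open>k\<close> and its values elsewhere. The maps
  with \<open>y k = k\<close> serve as representatives of the latter; the value \<open>k\<close> is
  an arbitrary default.\<close>

lemma sum_over_fun_upd: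
  fixes F :: "('n::finite \<Rightarrow> 'n) \<Rightarrow> 'b::comm_monoid_add"
  shows "(\<Sum>j\<in>UNIV. F j) = (\<Sum>y | y k = k. \<Sum>m\<in>UNIV. F (y(k := m)))"
  unfolding sum.cartesian_product
  by (rule sum.reindex_bij_witness
      [where i = "\<lambda>(y, m). y(k := m)" and j = "\<lambda>j. (j(k := k), j k)"]) auto

text \<open>The determinants on the right are the cofactors of row \<open>k\<close>. They do not
  involve \<open>v\<close>, so rows of two matrices can be compared through one vector of
  cofactors.\<close>

lemma det_expand_row:
  fixes v :: "'r::comm_ring_1 ^ 'n"
  shows "det (\<chi> i. if i = k then v else M i) =
    (\<Sum>l\<in>UNIV. v $ l * det (\<chi> i. if i = k then axis l 1 else M i))"
proof -
  have "det (\<chi> i. if i = k then v else M i) =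
      det (\<chi> i. if i = k then (\<Sum>l\<in>UNIV. v $ l *s axis l 1) else M i)"
    by (simp only: basis_expansion)
  also have "\<dots> = (\<Sum>l\<in>UNIV. det (\<chi> i. if i = k then v $ l *s axis l 1 else M i))"
    using det_linear_row_sum [of UNIV k "\<lambda>i l. v $ l *s axis l 1" M] by simp
  finally show ?thesis
    by (simp add: det_row_mul)
qed

text \<open>On a finite type a map that is not a permutation is not injective, so it repeats a
  row.\<close>

lemma det_rearranged_rows:
  fixes A :: "'r::comm_ring_1 ^ 'n ^ 'n"
  shows "det (\<chi> i. A $ j i) = (if j permutes UNIV then of_int (sign j) * det A else 0)"
proof (cases "inj j")
  case True
  then have "bij j"
    using finite_UNIV_inj_surj [of j] by (simp add: bij_def)
  then have "j permutes UNIV"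
    by (intro bij_imp_permutes) auto
  then show ?thesis
    by (simp add: det_permute_rows)
next
  case False
  then obtain i i' where "i \<noteq> i'" "j i = j i'"
    by (auto simp: inj_def)
  then have "det (\<chi> i. A $ j i) = 0"
    by (intro det_identical_rows [of i i']) (auto simp: row_def)
  moreover have "\<not> j permutes UNIV"
    using False permutes_inj by blast
  ultimately show ?thesis
    by simp
qed

text \<open>Determinants need entries in a commutative ring, which the bounded operators do not
  form. The entries are therefore taken from a commutative ring that acts on the space; below it is
  the polynomial ring, acting by evaluation at commuting operators.\<close>

locale ring_action =
  fixes act :: "'r::comm_ring_1 \<Rightarrow> 'h::real_normed_vector \<Rightarrow> 'h"
  assumes act_add: "act (a + b) x = act a x + act b x"
    and act_mult: "act (a * b) x = act a (act b x)"
begin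

lemma act_0 [simp]: "act 0 x = 0"
  using act_add [of 0 0 x] by simp

lemma act_minus [simp]: "act (- a) x = - act a x"
  using act_add [of a "- a" x] by (simp add: eq_neg_iff_add_eq_0 add.commute)

lemma act_diff: "act (a - b) x = act a x - act b x"
  using act_add [of a "- b" x] by simp

lemma act_sum: "act (\<Sum>i\<in>I. f i) x = (\<Sum>i\<in>I. act (f i) x)"
  by (induction I rule: infinite_finite_induct) (auto simp: act_add)

text \<open>
  The rows of \<open>C\<close> are exchanged for rows of \<open>B\<close> one at a time; summing over all ways to pick
  the rows with repetition makes the hypothesis applicable in each step.  In tensor notation, this
  applies \<open>B\<close> or \<open>C\<close> to each factor of an antisymmetric tensor.
\<close>

lemma norm_act_det_le:
  fixes B C :: "'r ^ 'n ^ 'n"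
  assumes le: "\<And>y. (\<Sum>i\<in>UNIV. (norm (\<Sum>j\<in>UNIV. act (B $ i $ j) (y j)))\<^sup>2) \<le>
                   (\<Sum>i\<in>UNIV. (norm (\<Sum>j\<in>UNIV. act (C $ i $ j) (y j)))\<^sup>2)"
  shows "norm (act (det B) x) \<le> norm (act (det C) x)"
proof -
  define V where "V K j = det (\<chi> i. if i \<in> K then B $ j i else C $ j i)" for K and j :: "'n \<Rightarrow> 'n"
  have step: "(\<Sum>j\<in>UNIV. (norm (act (V (insert k K) j) x))\<^sup>2) \<le> (\<Sum>j\<in>UNIV. (norm (act (V K j) x))\<^sup>2)"
    if "k \<notin> K" for k K
  proof -
    have "(\<Sum>m\<in>UNIV. (norm (act (V (insert k K) (y(k := m))) x))\<^sup>2) \<le>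
          (\<Sum>m\<in>UNIV. (norm (act (V K (y(k := m))) x))\<^sup>2)" for y
    proof -
      define M where "M i = (if i \<in> K then B $ y i else C $ y i)" for i
      \<comment> \<open>These are the cofactors of row \<open>k\<close> applied to \<open>x\<close>.
        They are the same for all \<open>m\<close> and for rows of \<open>B\<close> and of
        \<open>C\<close>, so \<open>le\<close> at \<open>w\<close> compares the two sums over
        \<open>m\<close>.\<close>
      define w where "w l = act (det (\<chi> i. if i = k then axis l 1 else M i)) x" for l
      have expand: "act (det (\<chi> i. if i = k then v else M i)) x = (\<Sum>l\<in>UNIV. act (v $ l) (w l))" for v
        unfolding det_expand_row [of k v M] by (simp add: act_sum act_mult w_def)
      have "V (insert k K) (y(k := m)) = det (\<chi> i. if i = k then B $ m else M i)"
        and "V K (y(k := m)) = det (\<chi> i. if i = k then C $ m else M i)" for m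
        using that unfolding V_def M_def by (auto intro!: arg_cong [of _ _ det] simp: vec_eq_iff)
      then show ?thesis
        using le [of w] by (simp add: expand)
    qed
    then show ?thesis
      unfolding sum_over_fun_upd [where k = k] by (rule sum_mono)
  qed
  have "(\<Sum>j\<in>UNIV. (norm (act (V K j) x))\<^sup>2) \<le> (\<Sum>j\<in>UNIV. (norm (act (V {} j) x))\<^sup>2)" for K
  proof (induction K rule: finite_induct [OF finite])
    case (2 k K)
    then show ?case
      using step [of k K] by linarith
  qed simp
  then have "(\<Sum>j\<in>UNIV. (norm (act (V UNIV j) x))\<^sup>2) \<le> (\<Sum>j\<in>UNIV. (norm (act (V {} j) x))\<^sup>2)" .
  \<comment> \<open>If all rows come from one matrix, only permutations contribute, and they all
    contribute the same squared norm.\<close>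
  moreover have "(\<Sum>j\<in>UNIV. (norm (act (det (\<chi> i. A $ j i)) x))\<^sup>2) =
      real (card {j. j permutes (UNIV :: 'n set)}) * (norm (act (det A) x))\<^sup>2"
    for A :: "'r ^ 'n ^ 'n"
  proof -
    have "(norm (act (det (\<chi> i. A $ j i)) x))\<^sup>2 =
        (if j permutes UNIV then (norm (act (det A) x))\<^sup>2 else 0)" for j
      by (simp add: det_rearranged_rows sign_def)
    then show ?thesis
      by (simp add: sum.If_cases)
  qed
  moreover have "card {j. j permutes (UNIV :: 'n set)} > 0"
    by (simp add: card_permutations)
  ultimately have "(norm (act (det B) x))\<^sup>2 \<le> (norm (act (det C) x))\<^sup>2"
    by (simp add: V_def)
  then show ?thesis
    by (rule power2_le_imp_le) simp
qed

end

text \<open>A permutation contributes only if it fixes every index other than \<open>k\<close>, and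
  then it is the identity.\<close>

lemma det_diagonal_but_one_row:
  fixes z w :: "'n::finite \<Rightarrow> 'r::comm_ring_1"
  shows "det (\<chi> i j. if i = k then w j else if i = j then z i else 0) = w k * (\<Prod>i\<in>UNIV - {k}. z i)"
    (is "det ?A = _")
proof -
  have "det ?A = (\<Sum>p | p permutes (UNIV::'n set). if p = id then \<Prod>i\<in>UNIV. ?A $ i $ i else 0)"
    unfolding det_def
  proof (intro sum.cong refl)
    fix p assume "p \<in> {p. p permutes (UNIV::'n set)}"
    then have p: "p permutes UNIV" by simp
    show "of_int (sign p) * (\<Prod>i\<in>UNIV. ?A $ i $ p i) = (if p = id then \<Prod>i\<in>UNIV. ?A $ i $ i else 0)"
    proof (cases "p = id")
      case False
      have "\<exists>i. i \<noteq> k \<and> p i \<noteq> i"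
      proof (rule ccontr)
        assume "\<not> ?thesis"
        then have fix_i: "p i = i" if "i \<noteq> k" for i using that by blast
        then have "p k = k"
          using p by (metis permutes_inv_eq)
        with fix_i have "p = id" by (metis eq_id_iff)
        with False show False by simp
      qed
      then obtain i where "i \<noteq> k" "p i \<noteq> i" by blast
      then have "?A $ i $ p i = 0" by auto
      then have "(\<Prod>i\<in>UNIV. ?A $ i $ p i) = 0"
        by (meson UNIV_I finite prod_zero)
      with False show ?thesis by simp
    qed (simp add: sign_id)
  qed
  also have "\<dots> = (\<Prod>i\<in>UNIV. ?A $ i $ i)"
    by (simp add: permutes_id)
  also have "\<dots> = w k * (\<Prod>i\<in>UNIV - {k}. ?A $ i $ i)"
    by (subst prod.remove [of _ k]) auto
  also have "(\<Prod>i\<in>UNIV - {k}. ?A $ i $ i) = (\<Prod>i\<in>UNIV - {k}. z i)"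
    by (intro prod.cong) auto
  finally show ?thesis .
qed

text \<open>The rank-one term is added to the rows of \<open>D\<close> one at a time;
  \<open>P S\<close> carries it in the rows of \<open>S\<close> only. By linearity in the new row,
  each step adds one determinant with a row \<open>W\<close>.\<close>

lemma det_diagonal_plus_rank_one:
  fixes z u w :: "'n::finite \<Rightarrow> 'r::comm_ring_1"
  shows "det (\<chi> i j. (if i = j then z i else 0) + u i * w j) =
    (\<Prod>i\<in>UNIV. z i) + (\<Sum>i\<in>UNIV. u i * w i * (\<Prod>j\<in>UNIV - {i}. z j))"
proof -
  define D :: "'r ^ 'n ^ 'n" where "D = (\<chi> i j. if i = j then z i else 0)"
  define W :: "'r ^ 'n" where "W = (\<chi> j. w j)"
  define P where "P S i = D $ i + (if i \<in> S then u i else 0) *s W" for S i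
  have P_empty: "P {} i = D $ i" for i
    by (simp add: P_def vec_eq_iff)
  \<comment> \<open>A row equal to \<open>W\<close> absorbs the multiples of \<open>W\<close> in all
    other rows by row operations.\<close>
  have row_k: "det (\<chi> i. if i = k then W else P S i) = det (\<chi> i. if i = k then W else D $ i)" 
    if "finite S" "k \<notin> S" for S k
    using that
  proof (induction S rule: finite_induct)
    case empty
    then show ?case by (simp only: P_empty)
  next
    case (insert l S)
    let ?A = "\<chi> i. if i = k then W else P S i"
    have "det (\<chi> i. if i = l then row l ?A + u l *s row k ?A else row i ?A) = det ?A"
      using insert by (intro det_row_operation) auto
    moreover have "(\<chi> i. if i = l then row l ?A + u l *s row k ?A else row i ?A) =
        (\<chi> i. if i = k then W else P (insert l S) i)"
      using insert by (auto simp: vec_eq_iff row_def P_def)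
    ultimately show ?case
      using insert by simp
  qed
  have "det (\<chi> i. P S i) = (\<Prod>i\<in>UNIV. z i) + (\<Sum>i\<in>S. u i * w i * (\<Prod>j\<in>UNIV - {i}. z j))"
    if "finite S" for S
    using that
  proof (induction S rule: finite_induct)
    case empty
    have "det D = (\<Prod>i\<in>UNIV. z i)"
      by (subst det_diagonal) (simp_all add: D_def)
    then show ?case by (simp add: P_empty)
  next
    case (insert k S)
    have "(\<chi> i. P (insert k S) i) = (\<chi> i. if i = k then D $ k + u k *s W else P S i)"
      by (auto simp: vec_eq_iff P_def)
    also have "det \<dots> = det (\<chi> i. if i = k then D $ k else P S i) + u k * det (\<chi> i. if i = k then W else P S i)"
      using det_row_add [of k "\<lambda>i. D $ k" "\<lambda>i. u k *s W" "P S"]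
        det_row_mul [of k "u k" "\<lambda>i. W" "P S"] by simp
    also have "(\<chi> i. if i = k then D $ k else P S i) = (\<chi> i. P S i)"
      using insert by (auto simp: vec_eq_iff P_def)
    also have "det (\<chi> i. if i = k then W else P S i) = det (\<chi> i. if i = k then W else D $ i)"
      using insert by (intro row_k) auto
    also have "(\<chi> i. if i = k then W else D $ i) =
        (\<chi> i j. if i = k then w j else if i = j then z i else 0)"
      by (auto simp: vec_eq_iff W_def D_def)
    also have "det \<dots> = w k * (\<Prod>i\<in>UNIV - {k}. z i)"
      by (rule det_diagonal_but_one_row)
    finally show ?case
      using insert by (simp add: algebra_simps)
  qed
  from this [of UNIV] have "det (\<chi> i. P UNIV i) =
      (\<Prod>i\<in>UNIV. z i) + (\<Sum>i\<in>UNIV. u i * w i * (\<Prod>j\<in>UNIV - {i}. z j))"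
    by simp
  moreover have "(\<chi> i. P UNIV i) = (\<chi> i j. (if i = j then z i else 0) + u i * w j)"
    by (auto simp: vec_eq_iff P_def D_def W_def)
  ultimately show ?thesis by simp
qed


section \<open>The polynomials with small coefficients\<close>

abbreviation rinner :: "'h::complex_inner \<Rightarrow> 'h \<Rightarrow> real"
  where "rinner x y \<equiv> Re (cinner x y)"

lemma rinner_commute: "rinner x y = rinner y x"
  by (subst cinner_commute) simp

lemma rinner_add_left: "rinner (x + y) z = rinner x z + rinner y z"
  by (simp add: cinner_add_left)

lemma rinner_add_right: "rinner z (x + y) = rinner z x + rinner z y"
  by (metis rinner_add_left rinner_commute)

lemma rinner_scaleR_left: "rinner (c *\<^sub>R x) y = c * rinner x y"
  by (simp add: scaleR_eq_scaleC cinner_scaleC_left)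

lemma rinner_scaleR_right: "rinner x (c *\<^sub>R y) = c * rinner x y"
  by (metis rinner_scaleR_left rinner_commute)

lemma rinner_sum_left: "rinner (\<Sum>i\<in>I. f i) y = (\<Sum>i\<in>I. rinner (f i) y)"
proof (induction I rule: infinite_finite_induct)
  case empty
  show ?case using rinner_scaleR_left [of 0 0 y] by simp
next
  case (infinite A)
  then show ?case using rinner_scaleR_left [of 0 0 y] by simp
qed (simp_all add: cinner_add_left)

lemma power2_norm_eq_rinner: "(norm x)\<^sup>2 = rinner x (x :: 'h::complex_inner)"
  using cinner_ge_zero [of x] by (simp add: norm_eq_sqrt_cinner)

lemma power2_norm_add:
  "(norm (x + y))\<^sup>2 = (norm x)\<^sup>2 + 2 * rinner x y + (norm (y :: 'h::complex_inner))\<^sup>2"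
  unfolding power2_norm_eq_rinner rinner_add_left rinner_add_right
  using rinner_commute [of x y] by simp

lemma sum_power2_norm_add_scaled:
  fixes y :: "'n::finite \<Rightarrow> 'h::complex_inner"
  shows "(\<Sum>i\<in>UNIV. (norm (y i + u i *\<^sub>R g))\<^sup>2) =
    (\<Sum>i\<in>UNIV. (norm (y i))\<^sup>2) + 2 * rinner (\<Sum>i\<in>UNIV. u i *\<^sub>R y i) g +
    (\<Sum>i\<in>UNIV. (u i)\<^sup>2) * (norm g)\<^sup>2"
  by (simp add: power2_norm_add rinner_sum_left rinner_scaleR_left rinner_scaleR_right
      sum.distrib power_mult_distrib mult.assoc flip: sum_distrib_left sum_distrib_right)

text \<open>
  With \<open>K = u u\<^sup>T\<close>, \<open>D = (1 - K\<^sup>2)\<^bsup>-1/2\<^esup> = 1 + t K\<close> and \<open>\<kappa> u = D u\<close>, this is the identity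
  \<open>|D (1 - K Z) y|\<^sup>2 - |D (Z - K) y|\<^sup>2 = |y|\<^sup>2 - |Z y|\<^sup>2\<close>, where \<open>z = Z y\<close>.
\<close>

lemma moebius_identity:
  fixes y z :: "'n::finite \<Rightarrow> 'h::complex_inner" and u :: "'n \<Rightarrow> real"
  defines "\<eta> \<equiv> \<Sum>i\<in>UNIV. u i *\<^sub>R y i" and "\<xi> \<equiv> \<Sum>i\<in>UNIV. u i *\<^sub>R z i"
    and "s \<equiv> \<Sum>i\<in>UNIV. (u i)\<^sup>2"
  assumes \<kappa>: "s * \<kappa>\<^sup>2 = s * t\<^sup>2 + 2 * t"
  shows "(\<Sum>i\<in>UNIV. (norm (y i + u i *\<^sub>R (t *\<^sub>R \<eta> + (- \<kappa>) *\<^sub>R \<xi>)))\<^sup>2) -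
         (\<Sum>i\<in>UNIV. (norm (z i + u i *\<^sub>R (t *\<^sub>R \<xi> + (- \<kappa>) *\<^sub>R \<eta>)))\<^sup>2) =
         (\<Sum>i\<in>UNIV. (norm (y i))\<^sup>2) - (\<Sum>i\<in>UNIV. (norm (z i))\<^sup>2)"
proof -
  \<comment> \<open>The terms in \<open>rinner \<eta> \<xi>\<close> cancel, and the assumption on
    \<kappa> makes the factor that remains vanish.\<close>
  have "2 * rinner \<eta> (t *\<^sub>R \<eta> + (- \<kappa>) *\<^sub>R \<xi>) + s * (norm (t *\<^sub>R \<eta> + (- \<kappa>) *\<^sub>R \<xi>))\<^sup>2 -
        (2 * rinner \<xi> (t *\<^sub>R \<xi> + (- \<kappa>) *\<^sub>R \<eta>) + s * (norm (t *\<^sub>R \<xi> + (- \<kappa>) *\<^sub>R \<eta>))\<^sup>2) =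
        (s * t\<^sup>2 + 2 * t - s * \<kappa>\<^sup>2) * (rinner \<eta> \<eta> - rinner \<xi> \<xi>)"
    unfolding power2_norm_eq_rinner rinner_add_left rinner_add_right
      rinner_scaleR_left rinner_scaleR_right rinner_commute [of \<xi> \<eta>]
    by (simp add: algebra_simps power2_eq_square)
  then show ?thesis
    unfolding sum_power2_norm_add_scaled \<kappa> by (simp add: \<eta>_def \<xi>_def s_def)
qed

text \<open>The embedding \<iota> allows the real numbers \<open>t\<close>, \<kappa> and
  \<open>u i\<close> to enter matrices over the acting ring.\<close>

locale real_algebra_action = ring_action act
  for act :: "'r::comm_ring_1 \<Rightarrow> 'h::complex_inner \<Rightarrow> 'h" +
  fixes \<iota> :: "real \<Rightarrow> 'r"
  assumes \<iota>_add: "\<iota> (a + b) = \<iota> a + \<iota> b"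
    and \<iota>_mult: "\<iota> (a * b) = \<iota> a * \<iota> b"
    and \<iota>_1: "\<iota> 1 = 1"
    and act_\<iota>: "act (\<iota> a) x = a *\<^sub>R x"
begin

lemma \<iota>_0: "\<iota> 0 = 0"
  using \<iota>_add [of 0 0] by simp

lemma \<iota>_sum: "\<iota> (\<Sum>i\<in>I. f i) = (\<Sum>i\<in>I. \<iota> (f i))"
  by (induction I rule: infinite_finite_induct) (simp_all add: \<iota>_0 \<iota>_add)

lemma norm_reflected_le_strict:
  fixes d :: "'n::finite \<Rightarrow> 'r" and \<alpha> :: "'n \<Rightarrow> real"
  assumes d: "\<And>i y. norm (act (d i) y) \<le> norm y"
    and \<alpha>: "\<And>i. 0 \<le> \<alpha> i" and less1: "(\<Sum>i\<in>UNIV. \<alpha> i) < 1"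
  shows "norm (act ((\<Prod>i\<in>UNIV. d i) - (\<Sum>i\<in>UNIV. \<iota> (\<alpha> i) * (\<Prod>j\<in>UNIV - {i}. d j))) x)
       \<le> norm (act (1 - (\<Sum>i\<in>UNIV. \<iota> (\<alpha> i) * d i)) x)"
    (is "norm (act ?q x) \<le> norm (act ?p x)")
proof -
  define s where "s = (\<Sum>i\<in>UNIV. \<alpha> i)"
  define u where "u i = sqrt (\<alpha> i)" for i
  \<comment> \<open>Here \<open>s\<close> is the eigenvalue of \<open>K\<close> at \<open>u\<close>,
    so \<kappa> is the eigenvalue of \<open>D\<close> there, and \<open>D = 1 + t K\<close>. For
    \<open>s = 0\<close> division by zero gives \<open>t = 0\<close>, which fits
    \<open>\<kappa> = 1\<close>.\<close>
  define \<kappa> where "\<kappa> = 1 / sqrt (1 - s\<^sup>2)"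
  define t where "t = (\<kappa> - 1) / s"
  have "0 \<le> s" "s < 1"
    using \<alpha> less1 by (auto simp: s_def sum_nonneg)
  then have s2: "s\<^sup>2 < 1"
    by (simp add: power_less_one_iff)
  then have "0 < \<kappa>" and \<kappa>2: "\<kappa>\<^sup>2 * (1 - s\<^sup>2) = 1"
    by (simp_all add: \<kappa>_def power_divide)
  have \<kappa>_eq: "\<kappa> = 1 + t * s"
    by (cases "s = 0") (simp_all add: t_def \<kappa>_def)
  have quad: "s * \<kappa>\<^sup>2 = s * t\<^sup>2 + 2 * t"
  proof (cases "s = 0")
    case True
    then show ?thesis by (simp add: t_def)
  next
    case False
    have "s * (s * \<kappa>\<^sup>2) = \<kappa>\<^sup>2 - 1"
      using \<kappa>2 by algebra
    also have "\<dots> = s * (s * t\<^sup>2 + 2 * t)"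
      unfolding \<kappa>_eq by (simp add: algebra_simps power2_eq_square)
    finally show ?thesis
      using False by simp
  qed
  have uu: "\<iota> (u i) * \<iota> (u i) = \<iota> (\<alpha> i)" for i
    using \<alpha> by (simp add: u_def flip: \<iota>_mult)
  have sum_u2: "(\<Sum>i\<in>UNIV. (u i)\<^sup>2) = s"
    using \<alpha> by (simp add: u_def s_def)
  \<comment> \<open>Multiplying out \<open>D (Z - K)\<close> and \<open>D (1 - K Z)\<close> with
    \<open>K\<^sup>2 = s K\<close> and \<open>1 + t s = \<kappa>\<close> gives
    \<open>B = Z + t K Z - \<kappa> K\<close> and \<open>C = 1 + t K - \<kappa> K Z\<close>, a
    diagonal matrix plus a rank-one matrix in both cases.\<close>
  define B :: "'r ^ 'n ^ 'n" where
    "B = (\<chi> i j. (if i = j then d i else 0) + \<iota> (u i) * (\<iota> (u j) * (\<iota> t * d j - \<iota> \<kappa>)))"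
  define C :: "'r ^ 'n ^ 'n" where
    "C = (\<chi> i j. (if i = j then 1 else 0) + \<iota> (u i) * (\<iota> (u j) * (\<iota> t - \<iota> \<kappa> * d j)))"
  have "norm (act (det B) x) \<le> norm (act (det C) x)"
  proof (rule norm_act_det_le)
    fix y :: "'n \<Rightarrow> 'h"
    define z where "z i = act (d i) (y i)" for i
    define \<eta> where "\<eta> = (\<Sum>i\<in>UNIV. u i *\<^sub>R y i)"
    define \<xi> where "\<xi> = (\<Sum>i\<in>UNIV. u i *\<^sub>R z i)"
    have if_act: "act (if i = j then a else 0) v = (if i = j then act a v else 0)" for i j :: 'n and a v
      by simp
    have "(\<Sum>j\<in>UNIV. act (B $ i $ j) (y j)) = z i + u i *\<^sub>R (t *\<^sub>R \<xi> + (- \<kappa>) *\<^sub>R \<eta>)" for i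
      by (simp add: B_def act_add act_diff act_mult act_\<iota> if_act z_def \<xi>_def \<eta>_def sum.distrib
          scaleR_add_right scaleR_diff_right sum_subtractf sum_negf scaleR_sum_right mult.commute mult.left_commute)
    moreover have "(\<Sum>j\<in>UNIV. act (C $ i $ j) (y j)) = y i + u i *\<^sub>R (t *\<^sub>R \<eta> + (- \<kappa>) *\<^sub>R \<xi>)" for i
      using act_\<iota> [of 1]
      by (simp add: C_def act_add act_diff act_mult act_\<iota> \<iota>_1 if_act z_def \<xi>_def \<eta>_def sum.distrib
          scaleR_add_right scaleR_diff_right sum_subtractf sum_negf scaleR_sum_right mult.commute mult.left_commute)
    moreover have "(\<Sum>i\<in>UNIV. (norm (z i))\<^sup>2) \<le> (\<Sum>i\<in>UNIV. (norm (y i))\<^sup>2)"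
      unfolding z_def by (intro sum_mono power_mono d) auto
    ultimately show "(\<Sum>i\<in>UNIV. (norm (\<Sum>j\<in>UNIV. act (B $ i $ j) (y j)))\<^sup>2) \<le>
        (\<Sum>i\<in>UNIV. (norm (\<Sum>j\<in>UNIV. act (C $ i $ j) (y j)))\<^sup>2)"
      using moebius_identity [of u \<kappa> t y z, unfolded sum_u2, OF quad] by (simp add: \<eta>_def \<xi>_def)
  qed
  \<comment> \<open>The rank-one part adds \<open>t s\<close> times the product of all
    \<open>d i\<close>, so the factor \<open>1 + t s = \<kappa>\<close>, which is
    \<open>det D\<close>, comes out; the same happens for \<open>C\<close>.\<close>
  moreover have "det B = \<iota> \<kappa> * ?q"
  proof -
    have "\<iota> (u i) * (\<iota> (u i) * (\<iota> t * d i - \<iota> \<kappa>)) * (\<Prod>j\<in>UNIV - {i}. d j) =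
        \<iota> t * \<iota> (\<alpha> i) * (\<Prod>j\<in>UNIV. d j) - \<iota> \<kappa> * (\<iota> (\<alpha> i) * (\<Prod>j\<in>UNIV - {i}. d j))" for i
      unfolding uu [symmetric] by (subst (2) prod.remove [of _ i]) (simp_all add: algebra_simps)
    then have "det B = (\<Prod>i\<in>UNIV. d i) + (\<Sum>i\<in>UNIV. \<iota> t * \<iota> (\<alpha> i) * (\<Prod>j\<in>UNIV. d j) -
        \<iota> \<kappa> * (\<iota> (\<alpha> i) * (\<Prod>j\<in>UNIV - {i}. d j)))"
      unfolding B_def det_diagonal_plus_rank_one by simp
    also have "\<dots> = (1 + \<iota> t * \<iota> s) * (\<Prod>i\<in>UNIV. d i) -
        \<iota> \<kappa> * (\<Sum>i\<in>UNIV. \<iota> (\<alpha> i) * (\<Prod>j\<in>UNIV - {i}. d j))"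
      by (simp add: sum_subtractf s_def \<iota>_sum sum_distrib_left sum_distrib_right distrib_right)
    also have "1 + \<iota> t * \<iota> s = \<iota> \<kappa>"
      by (simp add: \<kappa>_eq \<iota>_add \<iota>_mult \<iota>_1)
    finally show ?thesis
      by (simp add: right_diff_distrib)
  qed
  moreover have "det C = \<iota> \<kappa> * ?p"
  proof -
    have "det C = 1 + (\<Sum>i\<in>UNIV. \<iota> t * \<iota> (\<alpha> i) - \<iota> \<kappa> * (\<iota> (\<alpha> i) * d i))"
      unfolding C_def det_diagonal_plus_rank_one uu [symmetric] by (simp add: algebra_simps)
    also have "\<dots> = 1 + \<iota> t * \<iota> s - \<iota> \<kappa> * (\<Sum>i\<in>UNIV. \<iota> (\<alpha> i) * d i)"
      by (simp add: sum_subtractf s_def \<iota>_sum sum_distrib_left)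
    also have "1 + \<iota> t * \<iota> s = \<iota> \<kappa>"
      by (simp add: \<kappa>_eq \<iota>_add \<iota>_mult \<iota>_1)
    finally show ?thesis
      by (simp add: right_diff_distrib)
  qed
  ultimately show ?thesis
    using \<open>0 < \<kappa>\<close> by (simp add: act_mult act_\<iota>)
qed

text \<open>The strict case applies to \<open>r * \<alpha> i\<close> for \<open>0 < r < 1\<close>.
  Both sides are norms of affine functions of \<open>r\<close>, so the inequality survives as
  \<open>r\<close> tends to 1.\<close>

lemma norm_reflected_le:
  fixes d :: "'n::finite \<Rightarrow> 'r" and \<alpha> :: "'n \<Rightarrow> real"
  assumes d: "\<And>i y. norm (act (d i) y) \<le> norm y"
    and \<alpha>: "\<And>i. 0 \<le> \<alpha> i" and le1: "(\<Sum>i\<in>UNIV. \<alpha> i) \<le> 1"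
  shows "norm (act ((\<Prod>i\<in>UNIV. d i) - (\<Sum>i\<in>UNIV. \<iota> (\<alpha> i) * (\<Prod>j\<in>UNIV - {i}. d j))) x)
       \<le> norm (act (1 - (\<Sum>i\<in>UNIV. \<iota> (\<alpha> i) * d i)) x)"
proof -
  define q where "q r = act (\<Prod>i\<in>UNIV. d i) x - r *\<^sub>R act (\<Sum>i\<in>UNIV. \<iota> (\<alpha> i) * (\<Prod>j\<in>UNIV - {i}. d j)) x" for r
  define p where "p r = act 1 x - r *\<^sub>R act (\<Sum>i\<in>UNIV. \<iota> (\<alpha> i) * d i) x" for r
  have "norm (q r) \<le> norm (p r)" if "0 < r" "r < 1" for r
  proof -
    have "r * (\<Sum>i\<in>UNIV. \<alpha> i) \<le> r"
      using that le1 by (intro mult_left_le) auto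
    then have "(\<Sum>i\<in>UNIV. r * \<alpha> i) < 1"
      using that unfolding sum_distrib_left [symmetric] by linarith
    then have "norm (act ((\<Prod>i\<in>UNIV. d i) - (\<Sum>i\<in>UNIV. \<iota> (r * \<alpha> i) * (\<Prod>j\<in>UNIV - {i}. d j))) x)
       \<le> norm (act (1 - (\<Sum>i\<in>UNIV. \<iota> (r * \<alpha> i) * d i)) x)"
      using d \<alpha> that by (intro norm_reflected_le_strict) auto
    then show ?thesis
      by (simp add: q_def p_def act_diff act_mult act_\<iota> \<iota>_mult mult.assoc flip: sum_distrib_left)
  qed
  then have "\<forall>\<^sub>F r in at_left 1. norm (q r) \<le> norm (p r)"
    using eventually_at_left_real [of 0 1] by (auto elim: eventually_mono)
  moreover have "((\<lambda>r. norm (q r)) \<longlongrightarrow> norm (q 1)) (at_left 1)"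
    "((\<lambda>r. norm (p r)) \<longlongrightarrow> norm (p 1)) (at_left 1)"
    unfolding q_def p_def by (intro tendsto_intros)+
  ultimately have "norm (q 1) \<le> norm (p 1)"
    by (intro tendsto_le [OF trivial_limit_at_left_real])
  then show ?thesis
    by (simp add: q_def p_def act_diff)
qed

end


section \<open>Polynomials in commuting operators\<close>

text \<open>Every finitely supported map is a sum of monomials, so additive identities need checking
  on monomials only.\<close>

lemma poly_mapping_single_induct:
  fixes p :: "'k \<Rightarrow>\<^sub>0 'r::comm_monoid_add"
  assumes zero: "P 0" and single: "\<And>k c. P (Poly_Mapping.single k c)"
    and add: "\<And>p q. P p \<Longrightarrow> P q \<Longrightarrow> P (p + q)"
  shows "P p"
proof (induction p rule: update_induct)
  case (update p k c)
  then have "Poly_Mapping.update k c p = p + Poly_Mapping.single k c"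
    by (intro poly_mapping_eqI) (auto simp: lookup_update lookup_add lookup_single in_keys_iff when_def)
  with update show ?case
    by (simp add: add single)
qed (rule zero)

text \<open>Cancellation can shrink the support of \<open>p + q\<close>. All three sums are extended
  to the union of the supports of \<open>p\<close> and \<open>q\<close>, where the extra terms
  vanish by \<open>f0\<close>.\<close>

lemma sum_keys_add:
  fixes f :: "'k \<Rightarrow> 'r::comm_monoid_add \<Rightarrow> 'b::comm_monoid_add"
  assumes f0: "\<And>k. f k 0 = 0" and f_add: "\<And>k a b. f k (a + b) = f k a + f k b"
  shows "(\<Sum>k\<in>Poly_Mapping.keys (p + q). f k (poly_mapping.lookup (p + q) k)) =
    (\<Sum>k\<in>Poly_Mapping.keys p. f k (poly_mapping.lookup p k)) +
    (\<Sum>k\<in>Poly_Mapping.keys q. f k (poly_mapping.lookup q k))"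
proof -
  let ?K = "Poly_Mapping.keys p \<union> Poly_Mapping.keys q"
  have *: "(\<Sum>k\<in>Poly_Mapping.keys r. f k (poly_mapping.lookup r k)) = (\<Sum>k\<in>?K. f k (poly_mapping.lookup r k))"
    if "Poly_Mapping.keys r \<subseteq> ?K" for r
    using that by (intro sum.mono_neutral_left) (auto simp: f0 in_keys_iff)
  show ?thesis
    unfolding * [OF keys_add] * [OF Un_upper1] * [OF Un_upper2]
    by (simp add: lookup_add f_add sum.distrib)
qed

section \<open>Complex scaling and powers of bounded operators\<close>

lemma scaleC_blinfun_apply [simp]: "blinfun_apply (scaleC_blinfun c A) x = c *\<^sub>C blinfun_apply A x"
  by (simp add: scaleC_blinfun.rep_eq)

lemma scaleC_0_left [simp]: "0 *\<^sub>C x = (0 :: 'h::complex_inner)"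
  using scaleR_eq_scaleC [of 0 x] by simp

lemma scaleC_1_left [simp]: "1 *\<^sub>C x = (x :: 'h::complex_inner)"
  using scaleR_eq_scaleC [of 1 x] by simp

lemma norm_scaleC_blinfun: "norm (scaleC_blinfun c A) \<le> cmod c * norm A"
  by (rule norm_blinfun_bound)
    (auto simp: norm_scaleC mult.assoc intro!: mult_left_mono norm_blinfun)

lemma scaleC_blinfun_0_left [simp]: "scaleC_blinfun 0 A = 0"
  by (intro blinfun_eqI) simp

lemma scaleC_blinfun_add_left:
  "scaleC_blinfun (c + d) A = scaleC_blinfun c A + scaleC_blinfun d A"
  by (intro blinfun_eqI) (simp add: scaleC_add_left blinfun.add_left)

lemma scaleC_blinfun_scaleC_blinfun:
  "scaleC_blinfun c (scaleC_blinfun d A) = scaleC_blinfun (c * d) A"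
  by (intro blinfun_eqI) (simp add: scaleC_scaleC)

lemma bounded_linear_scaleC_blinfun:
  "bounded_linear (scaleC_blinfun c :: ('h::complex_inner \<Rightarrow>\<^sub>L 'h) \<Rightarrow> _)"
proof (rule bounded_linear_intro)
  fix A B :: "'h \<Rightarrow>\<^sub>L 'h" and r :: real
  show "scaleC_blinfun c (A + B) = scaleC_blinfun c A + scaleC_blinfun c B"
    by (intro blinfun_eqI) (simp add: scaleC_add_right blinfun.add_left)
  show "scaleC_blinfun c (r *\<^sub>R A) = r *\<^sub>R scaleC_blinfun c A"
    by (intro blinfun_eqI) (simp add: scaleR_eq_scaleC scaleC_scaleC mult.commute blinfun.scaleR_left)
  show "norm (scaleC_blinfun c A) \<le> norm A * cmod c"
    using norm_scaleC_blinfun [of c A] by (simp add: mult.commute)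
qed

lemma blinfun_pow_add: "blinfun_pow A (m + n) = blinfun_pow A m o\<^sub>L blinfun_pow A n"
  by (induction m) (auto intro!: blinfun_eqI simp: blinfun_pow_Suc)

lemma norm_blinfun_pow_le: "norm (blinfun_pow A n) \<le> norm A ^ n"
proof (induction n)
  case 0
  show ?case by (simp add: norm_blinfun_bound)
next
  case (Suc n)
  then show ?case
    unfolding blinfun_pow_Suc
    by (auto intro!: order_trans [OF norm_blinfun_compose] mult_left_mono)
qed

definition poly_op :: "('n::finite \<Rightarrow> ('h::complex_inner \<Rightarrow>\<^sub>L 'h)) \<Rightarrow> 'n cpoly \<Rightarrow> ('h \<Rightarrow>\<^sub>L 'h)"
  where "poly_op T p =
    (\<Sum>k\<in>Poly_Mapping.keys p. scaleC_blinfun (poly_mapping.lookup p k) (op_monomial T (poly_mapping.lookup k)))"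

lemma poly_op_0: "poly_op T 0 = 0"
  by (simp add: poly_op_def)

lemma poly_op_single:
  "poly_op T (Poly_Mapping.single k c) = scaleC_blinfun c (op_monomial T (poly_mapping.lookup k))"
  by (cases "c = 0") (simp_all add: poly_op_def)

lemma poly_op_add: "poly_op T (p + q) = poly_op T p + poly_op T q"
  unfolding poly_op_def by (rule sum_keys_add) (simp_all add: scaleC_blinfun_add_left)

context
  fixes T :: "'n::finite \<Rightarrow> ('h::complex_inner \<Rightarrow>\<^sub>L 'h)"
  assumes T: "commuting_strict_contractions T"
begin

lemma op_monomial_on_scaleC:
  "finite I \<Longrightarrow> op_monomial_on I T k (c *\<^sub>C x) = c *\<^sub>C op_monomial_on I T k x"
proof (induction I rule: finite_induct)
  case (insert i I)
  have "blinfun_pow (T i) n (c *\<^sub>C y) = c *\<^sub>C blinfun_pow (T i) n y" for n y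
    using T by (induction n) (simp_all add: blinfun_pow_Suc commuting_strict_contractions_def)
  with insert show ?case
    by (simp add: op_monomial_insert [OF T])
qed (simp add: op_monomial_empty)

lemma op_monomial_on_add:
  "finite I \<Longrightarrow> op_monomial_on I T (\<lambda>i. k i + l i) = op_monomial_on I T k o\<^sub>L op_monomial_on I T l"
proof (induction I rule: finite_induct)
  case empty
  show ?case by (auto intro: blinfun_eqI simp: op_monomial_empty)
next
  case (insert i I)
  have comm_pow: "blinfun_pow (T i) m (blinfun_pow (T j) n x) = blinfun_pow (T j) n (blinfun_pow (T i) m x)"
    for m n j x
  proof -
    have "T i o\<^sub>L T j = T j o\<^sub>L T i"
      using T by (simp add: commuting_strict_contractions_def)
    then show ?thesis
      by (metis blinfun_pow_commute blinfun_apply_blinfun_compose)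
  qed
  have "finite J \<Longrightarrow> blinfun_pow (T i) m (op_monomial_on J T k x) = op_monomial_on J T k (blinfun_pow (T i) m x)"
    for J m x
    by (induction J arbitrary: x rule: finite_induct)
      (simp_all add: op_monomial_empty op_monomial_insert [OF T] comm_pow)
  with insert show ?case
    by (intro blinfun_eqI) (simp add: op_monomial_insert [OF T] blinfun_pow_add)
qed

lemma op_monomial_0: "op_monomial T (\<lambda>i. 0) = id_blinfun"
proof -
  have "finite I \<Longrightarrow> op_monomial_on I T (\<lambda>i. 0) = id_blinfun" for I
    by (induction I rule: finite_induct)
      (auto intro: blinfun_eqI simp: op_monomial_empty op_monomial_insert [OF T])
  then show ?thesis by simp
qed

lemma op_monomial_single: "op_monomial T (poly_mapping.lookup (Poly_Mapping.single i 1)) = T i"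
proof -
  have "finite I \<Longrightarrow> op_monomial_on I T (poly_mapping.lookup (Poly_Mapping.single i 1)) = (if i \<in> I then T i else id_blinfun)" for I
    by (induction I rule: finite_induct)
      (auto intro!: blinfun_eqI simp: op_monomial_empty op_monomial_insert [OF T] lookup_single when_def
        blinfun_pow_def)
  then show ?thesis by simp
qed

lemma norm_op_monomial_le:
  assumes "\<And>i. norm (T i) \<le> r"
  shows "norm (op_monomial T k) \<le> (\<Prod>i\<in>UNIV. r ^ k i)"
proof -
  have r: "0 \<le> r" using assms norm_ge_zero order_trans by blast
  have "finite I \<Longrightarrow> norm (op_monomial_on I T k) \<le> (\<Prod>i\<in>I. r ^ k i)" for I
  proof (induction I rule: finite_induct)
    case empty
    show ?case by (simp add: op_monomial_empty norm_blinfun_bound)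
  next
    case (insert i I)
    have "norm (blinfun_pow (T i) (k i)) \<le> r ^ k i"
      using norm_blinfun_pow_le power_mono [OF assms norm_ge_zero] by (rule order_trans)
    with insert show ?case
      using r by (auto simp: op_monomial_insert [OF T]
          intro!: order_trans [OF norm_blinfun_compose] mult_mono)
  qed
  then show ?thesis by simp
qed

text \<open>Both sides are additive in \<open>p\<close> and in \<open>q\<close>. For monomials,
  commutativity merges the powers and complex linearity moves the coefficient of \<open>q\<close> to
  the front.\<close>

lemma poly_op_mult: "poly_op T (p * q) = poly_op T p o\<^sub>L poly_op T q"
proof (induction p rule: poly_mapping_single_induct)
  case (2 k c)
  show ?case
  proof (induction q rule: poly_mapping_single_induct)
    case (2 l d)
    show ?case
      by (intro blinfun_eqI)
        (simp add: mult_single poly_op_single plus_poly_mapping.rep_eq op_monomial_on_add op_monomial_on_scaleC scaleC_scaleC)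
  qed (auto intro!: blinfun_eqI simp: poly_op_0 poly_op_add distrib_left blinfun.add_right blinfun.add_left)
qed (auto intro!: blinfun_eqI simp: poly_op_0 poly_op_add distrib_right blinfun.add_left)

lemma poly_op_const_apply: "poly_op T (Poly_Mapping.single 0 c) x = c *\<^sub>C x"
  by (simp add: poly_op_single zero_poly_mapping.rep_eq op_monomial_0)

text \<open>This makes the determinant inequality available for commuting operators: the matrices
  have polynomial entries.\<close>

lemma real_algebra_action_poly_op:
  "real_algebra_action (\<lambda>p. blinfun_apply (poly_op T p)) (\<lambda>r. Poly_Mapping.single 0 (complex_of_real r))"
proof
qed (simp_all add: poly_op_add poly_op_mult blinfun.add_left blinfun.add_right poly_op_const_apply
      single_add mult_single scaleR_eq_scaleC)

end


section \<open>Power series in commuting operators\<close>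

text \<open>Completeness passes to the operator space, where absolute summability then implies
  summability.\<close>

instance chilbert_space \<subseteq> banach ..

text \<open>The coefficients of \<open>z\<^sup>m \<Sum>\<^sub>k b\<^sub>k z\<^sup>k\<close>.\<close>

definition shift_coeff :: "('n \<Rightarrow> nat) \<Rightarrow> (('n \<Rightarrow> nat) \<Rightarrow> complex) \<Rightarrow> ('n \<Rightarrow> nat) \<Rightarrow> complex"
  where "shift_coeff m b k = (if \<forall>i. m i \<le> k i then b (\<lambda>i. k i - m i) else 0)"

text \<open>The coefficients of \<open>p \<Sum>\<^sub>k b\<^sub>k z\<^sup>k\<close>.\<close>

definition mult_coeff :: "'n cpoly \<Rightarrow> (('n \<Rightarrow> nat) \<Rightarrow> complex) \<Rightarrow> ('n \<Rightarrow> nat) \<Rightarrow> complex"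
  where "mult_coeff p b k =
    (\<Sum>m\<in>Poly_Mapping.keys p. poly_mapping.lookup p m * shift_coeff (poly_mapping.lookup m) b k)"

lemma mult_coeff_single:
  "mult_coeff (Poly_Mapping.single m c) b k = c * shift_coeff (poly_mapping.lookup m) b k"
  by (cases "c = 0") (simp_all add: mult_coeff_def)

lemma mult_coeff_add: "mult_coeff (p + q) b k = mult_coeff p b k + mult_coeff q b k"
  unfolding mult_coeff_def by (rule sum_keys_add) (simp_all add: distrib_right)

text \<open>Composition with a fixed operator is bounded and moves into the sum. The substitution of
  \<open>m + k\<close> for \<open>k\<close> then reaches all exponents with a nonzero shifted
  coefficient.\<close>

lemma has_sum_shift_coeff:
  assumes T: "commuting_strict_contractions T"
    and R: "((\<lambda>k. scaleC_blinfun (b k) (op_monomial T k)) has_sum R) UNIV"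
  shows "((\<lambda>k. scaleC_blinfun (shift_coeff m b k) (op_monomial T k)) has_sum (op_monomial T m o\<^sub>L R)) UNIV"
proof -
  let ?f = "\<lambda>k. scaleC_blinfun (shift_coeff m b k) (op_monomial T k)"
  let ?h = "\<lambda>k i. m i + k i"
  have "op_monomial T m o\<^sub>L scaleC_blinfun (b k) (op_monomial T k) = (?f \<circ> ?h) k" for k
    by (intro blinfun_eqI)
      (simp add: shift_coeff_def op_monomial_on_add [OF T] op_monomial_on_scaleC [OF T])
  moreover have "((\<lambda>k. op_monomial T m o\<^sub>L scaleC_blinfun (b k) (op_monomial T k)) has_sum
      (op_monomial T m o\<^sub>L R)) UNIV"
    using R by (rule has_sum_bounded_linear
        [OF bounded_bilinear.bounded_linear_right [OF bounded_bilinear_blinfun_compose]])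
  ultimately have "((?f \<circ> ?h) has_sum (op_monomial T m o\<^sub>L R)) UNIV"
    by presburger
  then have "(?f has_sum (op_monomial T m o\<^sub>L R)) (range ?h)"
    by (subst has_sum_reindex) (auto simp: inj_def fun_eq_iff)
  moreover have "?f k = 0" if "k \<notin> range ?h" for k
  proof -
    have "\<not> (\<forall>i. m i \<le> k i)"
    proof
      assume "\<forall>i. m i \<le> k i"
      then have "k = ?h (\<lambda>i. k i - m i)" by auto
      then have "k \<in> range ?h" by (rule range_eqI [of _ _ "\<lambda>i. k i - m i"])
      with that show False by contradiction
    qed
    then show ?thesis
      by (auto simp: shift_coeff_def)
  qed
  ultimately show ?thesis
    by (subst (asm) has_sum_cong_neutral [of UNIV _ ?f]) auto
qed

lemma has_sum_mult_coeff:
  assumes T: "commuting_strict_contractions T"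
    and R: "((\<lambda>k. scaleC_blinfun (b k) (op_monomial T k)) has_sum R) UNIV"
  shows "((\<lambda>k. scaleC_blinfun (mult_coeff p b k) (op_monomial T k)) has_sum (poly_op T p o\<^sub>L R)) UNIV"
proof (induction p rule: poly_mapping_single_induct)
  case 1
  show ?case by (simp add: mult_coeff_def poly_op_def)
next
  case (2 m c)
  have "((\<lambda>k. scaleC_blinfun c (scaleC_blinfun (shift_coeff (poly_mapping.lookup m) b k) (op_monomial T k)))
      has_sum scaleC_blinfun c (op_monomial T (poly_mapping.lookup m) o\<^sub>L R)) UNIV"
    by (rule has_sum_bounded_linear [OF bounded_linear_scaleC_blinfun has_sum_shift_coeff [OF T R]])
  moreover have "scaleC_blinfun c (A o\<^sub>L R) = scaleC_blinfun c A o\<^sub>L R" for A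
    by (intro blinfun_eqI) simp
  ultimately show ?case
    by (simp add: mult_coeff_single poly_op_single scaleC_blinfun_scaleC_blinfun)
next
  case (3 p q)
  have "poly_op T (p + q) o\<^sub>L R = (poly_op T p o\<^sub>L R) + (poly_op T q o\<^sub>L R)"
    by (intro blinfun_eqI) (simp add: poly_op_add blinfun.add_left)
  then show ?case
    using has_sum_add [OF 3] by (simp add: mult_coeff_add scaleC_blinfun_add_left)
qed

text \<open>A finite set of exponents lies in a box, over which the sum factors into partial
  geometric sums, each at most \<open>1 / (1 - r)\<close>.\<close>

lemma summable_on_monomials:
  fixes r :: real
  assumes "0 \<le> r" "r < 1"
  shows "(\<lambda>k. \<Prod>i\<in>(UNIV :: 'n::finite set). r ^ k i) summable_on UNIV"
proof (rule nonneg_bounded_partial_sums_imp_summable_on)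
  show "\<forall>\<^sub>F X in finite_subsets_at_top UNIV.
      (\<Sum>k\<in>X. \<Prod>i\<in>(UNIV :: 'n set). r ^ k i) \<le> (1 / (1 - r)) ^ CARD('n)"
  proof (rule eventually_finite_subsets_at_top_weakI)
    fix X :: "('n \<Rightarrow> nat) set" assume "finite X"
    define N where "N = Max ((\<lambda>(k, i). k i) ` (X \<times> UNIV))"
    have "k i \<le> N" if "k \<in> X" for k i
      unfolding N_def using that \<open>finite X\<close> by (intro Max_ge) (auto intro!: image_eqI [of _ _ "(k, i)"])
    then have "X \<subseteq> PiE UNIV (\<lambda>_. {..N})"
      by auto
    then have "(\<Sum>k\<in>X. \<Prod>i\<in>(UNIV :: 'n set). r ^ k i) \<le> (\<Sum>k\<in>PiE UNIV (\<lambda>_. {..N}). \<Prod>i\<in>(UNIV :: 'n set). r ^ k i)"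
      by (rule sum_mono2 [rotated]) (use assms in \<open>auto intro!: finite_PiE prod_nonneg\<close>)
    also have "\<dots> = (\<Prod>i\<in>(UNIV :: 'n set). \<Sum>j\<le>N. r ^ j)"
      by (subst prod_sum_PiE) auto
    also have "\<dots> \<le> (\<Prod>i\<in>(UNIV :: 'n set). 1 / (1 - r))"
    proof -
      have "(\<Sum>j\<le>N. r ^ j) \<le> 1 / (1 - r)"
        using assms by (simp add: sum_gp0 divide_right_mono)
      then show ?thesis
        using assms by (intro prod_mono) (simp add: sum_nonneg)
    qed
    finally show "(\<Sum>k\<in>X. \<Prod>i\<in>(UNIV :: 'n set). r ^ k i) \<le> (1 / (1 - r)) ^ CARD('n)"
      by simp
  qed
qed (use assms in \<open>simp add: prod_nonneg\<close>)

text \<open>The largest of the finitely many norms is some \<open>r < 1\<close>, and the terms are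
  dominated by the monomials in \<open>r\<close>.\<close>

lemma ex_has_sum_power_series:
  fixes T :: "'n::finite \<Rightarrow> ('h::chilbert_space \<Rightarrow>\<^sub>L 'h)"
  assumes T: "commuting_strict_contractions T" and b: "\<And>k. cmod (b k) \<le> 1"
  shows "\<exists>R. ((\<lambda>k. scaleC_blinfun (b k) (op_monomial T k)) has_sum R) UNIV"
proof -
  define r where "r = Max (range (\<lambda>i. norm (T i)))"
  have r: "norm (T i) \<le> r" for i
    unfolding r_def by (intro Max_ge) auto
  have "r \<in> range (\<lambda>i. norm (T i))"
    unfolding r_def by (intro Max_in) auto
  then have "0 \<le> r" "r < 1"
    using T by (auto simp: commuting_strict_contractions_def)
  have "norm (scaleC_blinfun (b k) (op_monomial T k)) \<le> (\<Prod>i\<in>UNIV. r ^ k i)" for k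
  proof -
    have "norm (scaleC_blinfun (b k) (op_monomial T k)) \<le> 1 * norm (op_monomial T k)"
      using norm_scaleC_blinfun mult_right_mono [OF b norm_ge_zero] by (rule order_trans)
    then show ?thesis
      using norm_op_monomial_le [OF T r, of k] by simp
  qed
  then have "(\<lambda>k. scaleC_blinfun (b k) (op_monomial T k)) abs_summable_on UNIV"
    using summable_on_monomials [OF \<open>0 \<le> r\<close> \<open>r < 1\<close>]
    by (rule_tac summable_on_comparison_test) auto
  then show ?thesis
    by (metis abs_summable_summable has_sum_infsum)
qed


section \<open>The reciprocal of a linear polynomial\<close>

text \<open>The coefficients of \<open>1 / (1 - \<Sum>\<^sub>i a\<^sub>i z\<^sub>i)\<close>.\<close>

function recip_coeff :: "('n::finite \<Rightarrow> complex) \<Rightarrow> ('n \<Rightarrow> nat) \<Rightarrow> complex"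
  where "recip_coeff a k =
    (if k = (\<lambda>i. 0) then 1 else \<Sum>i | 0 < k i. a i * recip_coeff a (k(i := k i - 1)))"
  by pat_completeness auto
termination
  by (relation "Wellfounded.measure (\<lambda>(a, k). \<Sum>i\<in>UNIV. k i)") (auto intro!: sum_strict_mono_ex1)

declare recip_coeff.simps [simp del]

text \<open>The recursion bounds each modulus by earlier ones with weights \<open>cmod (a i)\<close>
  of total at most 1.\<close>

lemma norm_recip_coeff_le:
  assumes "(\<Sum>i\<in>UNIV. cmod (a i)) \<le> 1"
  shows "cmod (recip_coeff a k) \<le> 1"
  using assms
proof (induction a k rule: recip_coeff.induct)
  case (1 a k)
  show ?case
  proof (cases "k = (\<lambda>i. 0)")
    case False
    have "cmod (recip_coeff a k) \<le> (\<Sum>i | 0 < k i. cmod (a i) * cmod (recip_coeff a (k(i := k i - 1))))"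
      using False by (subst recip_coeff.simps) (auto intro!: order_trans [OF norm_sum] simp: norm_mult)
    also have "\<dots> \<le> (\<Sum>i | 0 < k i. cmod (a i))"
      using False 1(2) by (intro sum_mono mult_left_le 1(1)) auto
    also have "\<dots> \<le> (\<Sum>i\<in>UNIV. cmod (a i))"
      by (intro sum_mono2) auto
    finally show ?thesis
      using 1(2) by linarith
  qed (simp add: recip_coeff.simps)
qed

definition linear_poly :: "('n::finite \<Rightarrow> complex) \<Rightarrow> 'n cpoly"
  where "linear_poly a =
    Poly_Mapping.single 0 1 + (\<Sum>i\<in>UNIV. Poly_Mapping.single (Poly_Mapping.single i 1) (- a i))"

lemma linear_poly_eq: "1 - (\<Sum>i\<in>UNIV. poly_const (a i) * poly_var i) = linear_poly a"
  by (simp add: linear_poly_def poly_const_def poly_var_def mult_single single_uminus sum_negf)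

text \<open>Additivity avoids determining the support, which depends on which \<open>a i\<close>
  vanish.\<close>

lemma sum_keys_linear_poly:
  fixes f :: "('n::finite \<Rightarrow>\<^sub>0 nat) \<Rightarrow> complex \<Rightarrow> 'b::comm_monoid_add"
  assumes f0: "\<And>k. f k 0 = 0" and f_add: "\<And>k a b. f k (a + b) = f k a + f k b"
  shows "(\<Sum>k\<in>Poly_Mapping.keys (linear_poly a). f k (poly_mapping.lookup (linear_poly a) k)) =
    f 0 1 + (\<Sum>i\<in>UNIV. f (Poly_Mapping.single i 1) (- a i))"
proof -
  have "finite I \<Longrightarrow> (\<Sum>k\<in>Poly_Mapping.keys (sum g I). f k (poly_mapping.lookup (sum g I) k)) =
      (\<Sum>i\<in>I. \<Sum>k\<in>Poly_Mapping.keys (g i). f k (poly_mapping.lookup (g i) k))" for g and I :: "'n set"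
    by (induction I rule: finite_induct) (simp_all add: sum_keys_add f0 f_add)
  moreover have "(\<Sum>l\<in>Poly_Mapping.keys (Poly_Mapping.single k c). f l (poly_mapping.lookup (Poly_Mapping.single k c) l)) = f k c"
    for k c
    by (cases "c = 0") (simp_all add: f0)
  ultimately show ?thesis
    by (simp add: linear_poly_def sum_keys_add f0 f_add del: keys_single)
qed

text \<open>Comparing coefficients in \<open>(1 - \<Sum>\<^sub>i a\<^sub>i z\<^sub>i) b = 1\<close>
  gives exactly the recursion of \<open>recip_coeff\<close>.\<close>

lemma mult_coeff_linear_poly:
  "mult_coeff (linear_poly a) (recip_coeff a) k = (if k = (\<lambda>i. 0) then 1 else 0)"
proof -
  have "shift_coeff (poly_mapping.lookup (Poly_Mapping.single i 1)) b k =
      (if 0 < k i then b (k(i := k i - 1)) else 0)" for i b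
  proof -
    have "(\<forall>j. poly_mapping.lookup (Poly_Mapping.single i 1) j \<le> k j) \<longleftrightarrow> 0 < k i"
      by (auto simp: lookup_single when_def)
    moreover have "(\<lambda>j. k j - poly_mapping.lookup (Poly_Mapping.single i 1) j) = k(i := k i - 1)"
      by (auto simp: lookup_single when_def)
    ultimately show ?thesis
      by (simp add: shift_coeff_def)
  qed
  then have "mult_coeff (linear_poly a) (recip_coeff a) k =
      recip_coeff a k - (\<Sum>i\<in>UNIV. if 0 < k i then a i * recip_coeff a (k(i := k i - 1)) else 0)"
    unfolding mult_coeff_def
    by (subst sum_keys_linear_poly)
      (auto simp: distrib_right shift_coeff_def simp flip: sum_negf intro!: sum.cong)
  also have "\<dots> = (if k = (\<lambda>i. 0) then 1 else 0)"
    by (subst recip_coeff.simps) (simp add: sum.If_cases)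
  finally show ?thesis .
qed

text \<open>\<open>R\<close> is the reciprocal series evaluated at \<open>T\<close>. The
  coefficients of the series for \<open>q(T) R\<close> do not depend on \<open>T\<close>, so points
  and operator tuples share them.\<close>

lemma ex_recip_linear_poly:
  fixes T :: "'n::finite \<Rightarrow> ('h::chilbert_space \<Rightarrow>\<^sub>L 'h)"
  assumes T: "commuting_strict_contractions T" and a: "(\<Sum>i\<in>UNIV. cmod (a i)) \<le> 1"
  shows "\<exists>R. poly_op T (linear_poly a) o\<^sub>L R = id_blinfun \<and>
    (\<forall>q. ((\<lambda>k. scaleC_blinfun (mult_coeff q (recip_coeff a) k) (op_monomial T k)) has_sum
        (poly_op T q o\<^sub>L R)) UNIV)"
proof -
  obtain R where R: "((\<lambda>k. scaleC_blinfun (recip_coeff a k) (op_monomial T k)) has_sum R) UNIV"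
    using ex_has_sum_power_series [OF T, of "recip_coeff a"] norm_recip_coeff_le [OF a] by blast
  let ?f = "\<lambda>k. scaleC_blinfun (mult_coeff (linear_poly a) (recip_coeff a) k) (op_monomial T k)"
  have "(?f has_sum id_blinfun) UNIV"
  proof (rule has_sum_finite_neutralI)
    show "id_blinfun = sum ?f {\<lambda>i. 0}"
      by (auto intro!: blinfun_eqI simp: mult_coeff_linear_poly op_monomial_0 [OF T])
  qed (auto simp: mult_coeff_linear_poly)
  then have "poly_op T (linear_poly a) o\<^sub>L R = id_blinfun"
    using has_sum_mult_coeff [OF T R] has_sum_unique by blast
  then show ?thesis
    using has_sum_mult_coeff [OF T R] by blast
qed


section \<open>The reflected polynomial\<close>

text \<open>The exponent of the product of those variables in \<open>I\<close> that occur in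
  \<open>linear_poly a\<close>; for \<open>I = UNIV\<close> it is the multidegree.\<close>

definition support_exponent :: "('n::finite \<Rightarrow> complex) \<Rightarrow> 'n set \<Rightarrow> ('n \<Rightarrow>\<^sub>0 nat)"
  where "support_exponent a I = (\<Sum>i\<in>I. if a i = 0 then 0 else Poly_Mapping.single i 1)"

lemma lookup_support_exponent:
  "poly_mapping.lookup (support_exponent a I) j = (if j \<in> I \<and> a j \<noteq> 0 then 1 else 0)"
proof -
  have "poly_mapping.lookup (support_exponent a I) j = (\<Sum>i\<in>I. if i = j then (if a j = 0 then 0 else 1) else 0)"
    unfolding support_exponent_def lookup_sum
    by (intro sum.cong) (auto simp: lookup_single when_def)
  then show ?thesis
    by simp
qed

text \<open>\<open>reflected\<close> is a function on points; a polynomial is required for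
  evaluation at operators.\<close>

definition reflected_poly :: "('n::finite \<Rightarrow> complex) \<Rightarrow> 'n cpoly"
  where "reflected_poly a = Poly_Mapping.single (support_exponent a UNIV) 1 +
    (\<Sum>i\<in>UNIV. Poly_Mapping.single (support_exponent a (UNIV - {i})) (- cnj (a i)))"

lemma multidegree_linear_poly:
  fixes a :: "'n::finite \<Rightarrow> complex"
  shows "multidegree (linear_poly a) i = (if a i = 0 then 0 else 1)"
proof -
  have single_eq: "Poly_Mapping.single j (Suc 0) = Poly_Mapping.single i (Suc 0) \<longleftrightarrow> j = i" for i j :: 'n
    by (metis lookup_single_eq lookup_single_not_eq nat.distinct(1))
  have lookup: "poly_mapping.lookup (linear_poly a) k =
      (1 when k = 0) + (\<Sum>j\<in>UNIV. (- a j when Poly_Mapping.single j 1 = k))" for k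
    by (simp add: linear_poly_def lookup_add lookup_sum lookup_single lookup_one)
  have "k = 0 \<or> (\<exists>j. a j \<noteq> 0 \<and> k = Poly_Mapping.single j 1)" if "k \<in> Poly_Mapping.keys (linear_poly a)" for k
  proof (rule ccontr)
    assume *: "\<not> ?thesis"
    then have "(- a j when Poly_Mapping.single j 1 = k) = 0" for j
      by (auto simp: when_def)
    with * have "poly_mapping.lookup (linear_poly a) k = 0"
      unfolding lookup by (auto simp: when_def)
    with that show False by (simp add: in_keys_iff)
  qed
  then have le: "poly_mapping.lookup k i \<le> (if a i = 0 then 0 else 1)"
    if "k \<in> Poly_Mapping.keys (linear_poly a)" for k
    using that by (fastforce simp: lookup_single when_def)
  show ?thesis
  proof (cases "a i = 0")
    case True
    then show ?thesis
      unfolding multidegree_def using le by (intro Max_eqI) auto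
  next
    case False
    have "Poly_Mapping.single i 1 \<noteq> (0 :: 'n \<Rightarrow>\<^sub>0 nat)"
      by (metis lookup_single_eq lookup_zero zero_neq_one)
    then have "poly_mapping.lookup (linear_poly a) (Poly_Mapping.single i 1) = - a i"
      by (simp add: lookup when_def single_eq)
    then have "Poly_Mapping.single i 1 \<in> Poly_Mapping.keys (linear_poly a)"
      using False by (simp add: in_keys_iff)
    then have "1 \<in> (\<lambda>k. poly_mapping.lookup k i) ` Poly_Mapping.keys (linear_poly a)"
      by (rule rev_image_eqI) simp
    then show ?thesis
      unfolding multidegree_def using le False by (intro Max_eqI) auto
  qed
qed

lemma eval_poly_single: "eval_poly (Poly_Mapping.single k c) z = c * monomial_val z (poly_mapping.lookup k)"
  by (cases "c = 0") (simp_all add: eval_poly_def)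

lemma eval_poly_0: "eval_poly 0 z = 0"
  by (simp add: eval_poly_def)

lemma eval_poly_add: "eval_poly (p + q) z = eval_poly p z + eval_poly q z"
  unfolding eval_poly_def by (rule sum_keys_add) (simp_all add: distrib_right)

lemma eval_poly_sum: "eval_poly (\<Sum>i\<in>I. f i) z = (\<Sum>i\<in>I. eval_poly (f i) z)"
  by (induction I rule: infinite_finite_induct) (simp_all add: eval_poly_0 eval_poly_add)

lemma reflected_linear_poly: "reflected (linear_poly a) z = eval_poly (reflected_poly a) z"
proof -
  let ?m = "\<lambda>i. if a i = 0 then 0 else 1 :: nat"
  have exp1: "(\<lambda>i. ?m i - poly_mapping.lookup 0 i) = poly_mapping.lookup (support_exponent a UNIV)"
    by (auto simp: lookup_support_exponent)
  have exp2: "cnj (a j) * monomial_val z (\<lambda>i. ?m i - poly_mapping.lookup (Poly_Mapping.single j 1) i) =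
      cnj (a j) * monomial_val z (poly_mapping.lookup (support_exponent a (UNIV - {j})))" for j
  proof -
    have "(\<lambda>i. ?m i - poly_mapping.lookup (Poly_Mapping.single j 1) i) =
        poly_mapping.lookup (support_exponent a (UNIV - {j}))" if "a j \<noteq> 0"
      using that by (auto simp: lookup_support_exponent lookup_single when_def)
    then show ?thesis by (cases "a j = 0") auto
  qed
  have "reflected (linear_poly a) z =
      monomial_val z (\<lambda>i. ?m i - poly_mapping.lookup 0 i) +
      (\<Sum>j\<in>UNIV. - (cnj (a j) * monomial_val z (\<lambda>i. ?m i - poly_mapping.lookup (Poly_Mapping.single j 1) i)))"
    unfolding reflected_def multidegree_linear_poly
    by (subst sum_keys_linear_poly) (simp_all add: distrib_right)
  also have "\<dots> = eval_poly (reflected_poly a) z"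
    unfolding exp1 exp2 by (simp add: reflected_poly_def eval_poly_add eval_poly_sum eval_poly_single)
  finally show ?thesis .
qed

lemma prod_single:
  "(\<Prod>i\<in>I. Poly_Mapping.single (k i) (c i)) =
    (Poly_Mapping.single (\<Sum>i\<in>I. k i) (\<Prod>i\<in>I. c i) :: 'k::comm_monoid_add \<Rightarrow>\<^sub>0 'r::comm_ring_1)"
  by (induction I rule: infinite_finite_induct) (simp_all add: mult_single)

text \<open>
  Variables that do not occur in \<open>p\<close> are replaced by \<open>1\<close>, because they have degree \<open>0\<close> and hence
  do not occur in the reflected polynomial either.  The other variables are rotated to make
  the coefficients of \<open>p\<close> positive.
\<close>

lemma norm_reflected_poly_le:
  fixes T :: "'n::finite \<Rightarrow> ('h::complex_inner \<Rightarrow>\<^sub>L 'h)"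
  assumes T: "commuting_strict_contractions T" and a: "(\<Sum>i\<in>UNIV. cmod (a i)) \<le> 1"
  shows "norm (poly_op T (reflected_poly a) x) \<le> norm (poly_op T (linear_poly a) x)"
proof -
  interpret real_algebra_action "\<lambda>p. blinfun_apply (poly_op T p)" "\<lambda>r. Poly_Mapping.single 0 (complex_of_real r)"
    by (rule real_algebra_action_poly_op [OF T])
  \<comment> \<open>The phases of the coefficients. Since \<open>sgn 0 = 0\<close>, the value 1 at
    vanishing coefficients keeps every \<open>c i\<close> unimodular.\<close>
  define c where "c i = (if a i = 0 then 1 else sgn (a i))" for i
  define d :: "'n \<Rightarrow> 'n cpoly"
    where "d i = Poly_Mapping.single (if a i = 0 then 0 else Poly_Mapping.single i 1) (c i)" for i
  \<comment> \<open>Rotating the variables multiplies the reflected polynomial by this unimodular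
    constant, which leaves norms unchanged.\<close>
  define \<sigma> where "\<sigma> = (\<Prod>i\<in>UNIV. c i)"
  have norm_c: "cmod (c i) = 1" for i
    by (simp add: c_def norm_sgn)
  then have norm_\<sigma>: "cmod \<sigma> = 1"
    by (simp add: \<sigma>_def flip: prod_norm)
  have prod_d: "(\<Prod>i\<in>I. d i) = Poly_Mapping.single (support_exponent a I) (\<Prod>i\<in>I. c i)" for I
    by (simp add: d_def prod_single support_exponent_def)
  have "norm (poly_op T (d i) y) \<le> norm y" for i y
  proof (cases "a i = 0")
    case True
    then show ?thesis
      using poly_op_const_apply [OF T, of 1 y] by (simp add: d_def c_def)
  next
    case False
    have "norm (T i y) \<le> norm (T i) * norm y"
      by (rule norm_blinfun)
    also have "\<dots> \<le> 1 * norm y"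
      using T by (intro mult_right_mono) (auto simp: commuting_strict_contractions_def less_imp_le)
    finally show ?thesis
      using False norm_c [of i] op_monomial_single [OF T, of i]
      by (simp add: d_def poly_op_single norm_scaleC)
  qed
  then have "norm (poly_op T ((\<Prod>i\<in>UNIV. d i) -
        (\<Sum>i\<in>UNIV. Poly_Mapping.single 0 (complex_of_real (cmod (a i))) * (\<Prod>j\<in>UNIV - {i}. d j))) x)
      \<le> norm (poly_op T (1 - (\<Sum>i\<in>UNIV. Poly_Mapping.single 0 (complex_of_real (cmod (a i))) * d i)) x)"
    using a by (intro norm_reflected_le) auto
  also have "1 - (\<Sum>i\<in>UNIV. Poly_Mapping.single 0 (complex_of_real (cmod (a i))) * d i) = linear_poly a"
  proof -
    have "Poly_Mapping.single 0 (complex_of_real (cmod (a i))) * d i =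
        Poly_Mapping.single (Poly_Mapping.single i 1) (a i)" for i
      by (simp add: d_def c_def mult_single sgn_div_norm scaleR_conv_of_real mult.assoc [symmetric])
    then show ?thesis
      by (simp add: linear_poly_def single_uminus sum_negf)
  qed
  also have "(\<Prod>i\<in>UNIV. d i) -
      (\<Sum>i\<in>UNIV. Poly_Mapping.single 0 (complex_of_real (cmod (a i))) * (\<Prod>j\<in>UNIV - {i}. d j)) =
      Poly_Mapping.single 0 \<sigma> * reflected_poly a"
  proof -
    have "complex_of_real (cmod (a i)) * (\<Prod>j\<in>UNIV - {i}. c j) = \<sigma> * cnj (a i)" for i
    proof (cases "a i = 0")
      case False
      have "\<sigma> = c i * (\<Prod>j\<in>UNIV - {i}. c j)"
        unfolding \<sigma>_def by (intro prod.remove) auto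
      moreover have "c i * cnj (a i) = complex_of_real (cmod (a i))"
        using False complex_norm_square [of "a i"]
        by (simp add: c_def sgn_div_norm scaleR_conv_of_real power2_eq_square field_simps)
      ultimately show ?thesis
        by (simp add: mult.assoc mult.left_commute)
    qed simp
    then show ?thesis
      by (simp add: prod_d mult_single reflected_poly_def right_diff_distrib distrib_left sum_distrib_left
          single_uminus sum_negf flip: \<sigma>_def)
  qed
  finally show ?thesis
    by (simp add: poly_op_mult [OF T] poly_op_const_apply [OF T] norm_scaleC norm_\<sigma>)
qed


section \<open>Evaluation at points of the polydisc\<close>

text \<open>A point of the polydisc acts by multiplication on the one-dimensional Hilbert space of
  complex numbers, so the scalar power series is a case of the operator series.\<close>

lemma commuting_strict_contractions_mult:
  assumes "z \<in> polydisc"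
  shows "commuting_strict_contractions (\<lambda>i. blinfun_mult_right (z $ i))"
  unfolding commuting_strict_contractions_def
proof (intro conjI allI)
  fix i
  have "norm (blinfun_mult_right (z $ i)) \<le> cmod (z $ i)"
    by (rule norm_blinfun_bound) (auto simp: norm_mult)
  also have "\<dots> < 1"
    using assms by (simp add: polydisc_def)
  finally show "norm (blinfun_mult_right (z $ i)) < 1" .
qed (auto intro!: blinfun_eqI simp: scaleC_complex_def)

lemma op_monomial_mult:
  assumes "z \<in> polydisc"
  shows "op_monomial (\<lambda>i. blinfun_mult_right (z $ i)) k w = monomial_val z k * w"
proof -
  have pow: "blinfun_pow (blinfun_mult_right u) n w = u ^ n * w" for u w :: complex and n
    by (induction n) (simp_all add: blinfun_pow_Suc)
  have "finite I \<Longrightarrow> op_monomial_on I (\<lambda>i. blinfun_mult_right (z $ i)) k w = (\<Prod>i\<in>I. (z $ i) ^ k i) * w" for I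
    by (induction I rule: finite_induct)
      (simp_all add: op_monomial_empty op_monomial_insert [OF commuting_strict_contractions_mult [OF assms]] pow)
  then show ?thesis
    by (simp add: monomial_val_def)
qed

lemma poly_op_mult_apply:
  assumes "z \<in> polydisc"
  shows "poly_op (\<lambda>i. blinfun_mult_right (z $ i)) p w = eval_poly p z * w"
  by (induction p rule: poly_mapping_single_induct)
    (simp_all add: poly_op_0 eval_poly_0 poly_op_single eval_poly_single op_monomial_mult [OF assms]
      scaleC_complex_def poly_op_add eval_poly_add blinfun.add_left distrib_right)

theorem corollary5p7:
  fixes a :: "'n::finite \<Rightarrow> complex"
  assumes "(\<Sum>i\<in>UNIV. cmod (a i)) \<le> 1"
  shows "agler_denominator TYPE('h::chilbert_space) (1 - (\<Sum>i\<in>UNIV. poly_const (a i) * poly_var i))"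
proof -
  \<comment> \<open>The coefficients of the reflected polynomial times \<open>1/p\<close>, used both
    at points and at operators.\<close>
  let ?c = "mult_coeff (reflected_poly a) (recip_coeff a)"
  have point: "eval_poly (linear_poly a) z \<noteq> 0 \<and>
      ((\<lambda>k. ?c k * monomial_val z k) has_sum (reflected (linear_poly a) z / eval_poly (linear_poly a) z)) UNIV"
    if z: "z \<in> polydisc" for z
  proof -
    let ?T = "\<lambda>i. blinfun_mult_right (z $ i)"
    obtain R where R: "poly_op ?T (linear_poly a) o\<^sub>L R = id_blinfun"
      and sum: "((\<lambda>k. scaleC_blinfun (?c k) (op_monomial ?T k)) has_sum (poly_op ?T (reflected_poly a) o\<^sub>L R)) UNIV"
      using ex_recip_linear_poly [OF commuting_strict_contractions_mult [OF z] assms] by blast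
    \<comment> \<open>Applied to the vector 1, the inverse relation shows that \<open>p\<close> has
      no zero at \<open>z\<close>, which gives semi-stability, and that \<open>R 1\<close> is the
      reciprocal value.\<close>
    have "(poly_op ?T (linear_poly a) o\<^sub>L R) 1 = 1"
      by (simp add: R)
    then have R1: "eval_poly (linear_poly a) z * R 1 = 1"
      by (simp add: poly_op_mult_apply [OF z])
    then have nonzero: "eval_poly (linear_poly a) z \<noteq> 0"
      by auto
    with R1 have "R 1 = 1 / eval_poly (linear_poly a) z"
      by (simp add: field_simps)
    then have "(poly_op ?T (reflected_poly a) o\<^sub>L R) 1 =
        reflected (linear_poly a) z / eval_poly (linear_poly a) z"
      by (simp add: poly_op_mult_apply [OF z] reflected_linear_poly)
    moreover have "((\<lambda>k. scaleC_blinfun (?c k) (op_monomial ?T k) 1) has_sum (poly_op ?T (reflected_poly a) o\<^sub>L R) 1) UNIV"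
      using sum by (rule has_sum_bounded_linear [OF blinfun.bounded_linear_left])
    ultimately show ?thesis
      using nonzero by (simp add: op_monomial_mult [OF z] scaleC_complex_def)
  qed
  have "\<exists>F. ((\<lambda>k. scaleC_blinfun (?c k) (op_monomial T k)) has_sum F) UNIV \<and> norm F \<le> 1"
    if T: "commuting_strict_contractions T" for T :: "'n \<Rightarrow> ('h \<Rightarrow>\<^sub>L 'h)"
  proof -
    obtain R where R: "poly_op T (linear_poly a) o\<^sub>L R = id_blinfun"
      and sum: "((\<lambda>k. scaleC_blinfun (?c k) (op_monomial T k)) has_sum (poly_op T (reflected_poly a) o\<^sub>L R)) UNIV"
      using ex_recip_linear_poly [OF T assms] by blast
    have "norm (poly_op T (reflected_poly a) o\<^sub>L R) \<le> 1"
    proof (rule norm_blinfun_bound)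
      fix x
      \<comment> \<open>The inequality is used at the vector \<open>R x\<close>, which
        \<open>p(T)\<close> maps to \<open>x\<close>.\<close>
      have "norm (poly_op T (reflected_poly a) (R x)) \<le> norm (poly_op T (linear_poly a) (R x))"
        by (rule norm_reflected_poly_le [OF T assms])
      also have "poly_op T (linear_poly a) (R x) = x"
        using R by (metis blinfun_apply_blinfun_compose blinfun_apply_id_blinfun)
      finally show "norm ((poly_op T (reflected_poly a) o\<^sub>L R) x) \<le> 1 * norm x"
        by simp
    qed simp
    with sum show ?thesis by blast
  qed
  then have "schur_agler TYPE('h) (\<lambda>z. reflected (linear_poly a) z / eval_poly (linear_poly a) z)"
    unfolding schur_agler_def using point by blast
  then show ?thesis
    unfolding linear_poly_eq agler_denominator_def semi_stable_def using point by blast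
qed

end
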